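(* Let $A,B\in\mathbb{Z}$ with $B\neq 0$, and let $n,m$ be positive integers satisfying $1\le m<n$ and $n>2$. Assume that $\gcd(n,mB)=1$. Let $f(X)=X^n+A(BX+1)^m$ be irreducible over $\mathbb{Q}$, and let $D=n^n+(-1)^{n+m}B^n(n-m)^{n-m}m^mA$. Then $f$ is monogenic if and only if both $A$ and $D$ are square-free.
   Context: A monic irreducible polynomial $f\in\mathbb{Z}[X]$ with root $\theta$ is called monogenic if $\mathbb{Z}[\theta]=\mathcal{O}_K$, where $\mathcal{O}_K$ is the ring of integers of $K=\mathbb{Q}(\theta)$. An integer is square-free if it is not divisible by $p^2$ for any prime $p$ (so $\pm1$ are square-free and $0$ is not). *)

theory Defs
  imports Complex_Main
    "HOL-Computational_Algebra.Polynomial"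
    "HOL-Computational_Algebra.Squarefree"
begin

definition complex_subfield :: "complex set \<Rightarrow> bool" where
  "complex_subfield F \<longleftrightarrow>
     0 \<in> F \<and> 1 \<in> F \<and>
     (\<forall>x\<in>F. \<forall>y\<in>F. x + y \<in> F \<and> x - y \<in> F \<and> x * y \<in> F) \<and>
     (\<forall>x\<in>F. x \<noteq> 0 \<longrightarrow> inverse x \<in> F)"

text \<open>
  The number field \<open>\<rat>(\<theta>)\<close>, as the smallest subfield of the complex numbers containing
  \<open>\<theta>\<close>; every subfield of the complex numbers contains the rationals.
\<close>

definition rat_adjoin :: "complex \<Rightarrow> complex set" where
  "rat_adjoin \<theta> = \<Inter> {F. complex_subfield F \<and> \<theta> \<in> F}"

definition int_adjoin :: "complex \<Rightarrow> complex set" where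
  "int_adjoin \<theta> = range (\<lambda>p :: int poly. poly (map_poly of_int p) \<theta>)"

definition ring_of_integers :: "complex set \<Rightarrow> complex set" where
  "ring_of_integers K = {x \<in> K. algebraic_int x}"

text \<open>
  The condition is imposed at every complex root \<open>\<theta>\<close>. The roots of an irreducible polynomial
  are conjugate, so it holds at all of them as soon as it holds at one, and a monic
  irreducible polynomial has at least one root.
\<close>

definition monogenic :: "int poly \<Rightarrow> bool" where
  "monogenic f \<longleftrightarrow>
     lead_coeff f = 1 \<and> irreducible f \<and>
     (\<forall>\<theta> :: complex. poly (map_poly of_int f) \<theta> = 0 \<longrightarrow>
        int_adjoin \<theta> = ring_of_integers (rat_adjoin \<theta>))"

end

theory Submission
  imports Defs "Jordan_Normal_Form.Char_Poly" "HOL-Computational_Algebra.Field_as_Ring"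
    "HOL-Number_Theory.Cong"
begin

text \<open>
  Let \<open>E = B (n - m)\<close>. The identity \<open>(B X + 1) f' - m B f = X^(n-1) (E X + n)\<close> shows that modulo a
  prime \<open>p\<close> the only possible repeated root of \<open>f\<close> is \<open>0\<close> when \<open>p\<close> divides \<open>A\<close>, and \<open>-n/E\<close>
  otherwise; moreover \<open>f 0 = A\<close>, and \<open>E^n f a\<close> is congruent to \<open>\<plusminus>D\<close> when \<open>E a\<close> is congruent to \<open>-n\<close>.

  If \<open>p\<^sup>2\<close> divides \<open>f a\<close> and \<open>f' a\<close>, write \<open>f = (X - a)\<^sup>2 g + f' a (X - a) + f a\<close>; then
  \<open>(\<theta> - a) g(\<theta>) / p\<close> has its square in \<open>\<int>[\<theta>]\<close>, so it is an algebraic integer outside \<open>\<int>[\<theta>]\<close>.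

  Conversely, if \<open>h(\<theta>) / p\<close> is an algebraic integer outside \<open>\<int>[\<theta>]\<close>, the polynomials \<open>h\<close> with
  \<open>h(\<theta>) / p\<close> integral form an ideal whose monic element \<open>d\<close> of least degree gives a factorisation
  \<open>f = d w\<close> modulo \<open>p\<close> with \<open>w\<close> not constant and dividing a power of \<open>d\<close>. Hence \<open>d\<close> and \<open>w\<close> share the
  repeated root \<open>a\<close> of \<open>f\<close>. If \<open>p\<^sup>2\<close> did not divide \<open>f a\<close>, the maximal ideal \<open>(p, \<theta> - a)\<close> of \<open>\<int>[\<theta>]\<close>
  would be locally generated by \<open>\<theta> - a\<close>, which is incompatible with the integrality of
  \<open>d(\<theta>) / p\<close>. So \<open>p\<^sup>2\<close> divides \<open>A\<close> or \<open>D\<close>.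
\<close>

(* Otherwise smult would denote the module operation of HOL-Algebra. *)
hide_const (open) Module.smult

section \<open>Sums and products of algebraic integers\<close>

text \<open>The Z-submodule generated by a family. The index type is arbitrary so that pairs (i, j)
  can index the products a^i b^j in \<open>algebraic_int_add_mult\<close>.\<close>

definition int_span :: "'i set \<Rightarrow> ('i \<Rightarrow> complex) \<Rightarrow> complex set" where
  "int_span S v = range (\<lambda>c. \<Sum>s\<in>S. of_int (c s) * v s)"

lemma int_span_add: "x \<in> int_span S v \<Longrightarrow> y \<in> int_span S v \<Longrightarrow> x + y \<in> int_span S v"
proof -
  assume "x \<in> int_span S v" "y \<in> int_span S v"
  then obtain c d where "x = (\<Sum>s\<in>S. of_int (c s) * v s)" "y = (\<Sum>s\<in>S. of_int (d s) * v s)"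
    by (auto simp: int_span_def)
  then have "x + y = (\<Sum>s\<in>S. of_int (c s + d s) * v s)"
    by (simp add: sum.distrib distrib_right)
  then show ?thesis unfolding int_span_def by (rule range_eqI[of _ _ "\<lambda>s. c s + d s"])
qed

lemma int_span_mult_int: "x \<in> int_span S v \<Longrightarrow> of_int k * x \<in> int_span S v"
proof -
  assume "x \<in> int_span S v"
  then obtain c where "x = (\<Sum>s\<in>S. of_int (c s) * v s)"
    by (auto simp: int_span_def)
  then have "of_int k * x = (\<Sum>s\<in>S. of_int (k * c s) * v s)"
    by (simp add: sum_distrib_left mult.assoc)
  then show ?thesis unfolding int_span_def by (rule range_eqI[of _ _ "\<lambda>s. k * c s"])
qed

lemma int_span_0: "0 \<in> int_span S v"
  unfolding int_span_def by (rule range_eqI[of _ _ "\<lambda>_. 0"]) simp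

lemma int_span_sum: "(\<And>i. i \<in> I \<Longrightarrow> g i \<in> int_span S v) \<Longrightarrow> sum g I \<in> int_span S v"
  by (induction I rule: infinite_finite_induct) (auto intro: int_span_0 int_span_add)

lemma int_span_base:
  assumes "finite S" "s \<in> S"
  shows "v s \<in> int_span S v"
proof -
  have "(\<Sum>t\<in>S. of_int (if t = s then 1 else 0) * v t) = (\<Sum>t\<in>S. if t = s then v t else 0)"
    by (intro sum.cong) auto
  also have "\<dots> = v s"
    using assms by simp
  finally show ?thesis
    unfolding int_span_def by (intro range_eqI[of _ _ "\<lambda>t. if t = s then 1 else 0"]) simp
qed

lemma int_span_stable:
  assumes "\<And>s. s \<in> S \<Longrightarrow> x * v s \<in> int_span S v" and "y \<in> int_span S v"
  shows "x * y \<in> int_span S v"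
proof -
  from assms(2) obtain c where y: "y = (\<Sum>s\<in>S. of_int (c s) * v s)"
    by (auto simp: int_span_def)
  have "x * y = (\<Sum>s\<in>S. of_int (c s) * (x * v s))"
    by (simp add: y sum_distrib_left mult_ac)
  also have "\<dots> \<in> int_span S v"
    by (intro int_span_sum int_span_mult_int assms(1))
  finally show ?thesis .
qed

text \<open>The determinant trick: x is an eigenvalue of an integer matrix, hence a root of its
  characteristic polynomial, which is monic with integer coefficients.\<close>

lemma algebraic_int_if_eigen:
  fixes x :: complex and v :: "nat \<Rightarrow> complex" and c :: "nat \<Rightarrow> nat \<Rightarrow> int"
  assumes eig: "\<And>i. i < N \<Longrightarrow> x * v i = (\<Sum>j<N. of_int (c i j) * v j)"
    and nz: "k < N" "v k \<noteq> 0"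
  shows "algebraic_int x"
proof -
  define M where "M = mat N N (\<lambda>(i, j). c i j)"
  define M' :: "complex mat" where "M' = map_mat of_int M"
  have M: "M \<in> carrier_mat N N" and M': "M' \<in> carrier_mat N N"
    by (auto simp: M_def M'_def)
  have "eigenvector M' (vec N v) x"
    unfolding eigenvector_def
  proof (intro conjI)
    show "vec N v \<noteq> 0\<^sub>v (dim_row M')"
      using nz M' by (auto dest!: arg_cong[of _ _ "\<lambda>u. u $ k"])
    show "M' *\<^sub>v vec N v = x \<cdot>\<^sub>v vec N v"
      using eig by (intro eq_vecI) (auto simp: M'_def M_def scalar_prod_def atLeast0LessThan)
  qed (use M' in auto)
  then have "poly (char_poly M') x = 0"
    using eigenvalue_root_char_poly[OF M'] by (auto simp: eigenvalue_def)
  moreover have "char_poly M' = map_poly of_int (char_poly M)"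
    unfolding M'_def by (rule of_int_hom.char_poly_hom[OF M])
  ultimately have "poly (map_poly of_int (char_poly M)) x = 0"
    by simp
  moreover have "lead_coeff (char_poly M) = 1"
    using degree_monic_char_poly[OF M] by simp
  ultimately show ?thesis
    by (auto simp: algebraic_int_altdef_ipoly)
qed

lemma algebraic_int_if_int_span_stable:
  fixes x :: complex
  assumes fin: "finite S" and nz: "s \<in> S" "v s \<noteq> 0"
    and stable: "\<And>s. s \<in> S \<Longrightarrow> x * v s \<in> int_span S v"
  shows "algebraic_int x"
proof -
  obtain h where h: "bij_betw h {..<card S} S"
    using ex_bij_betw_nat_finite[OF fin] by (auto simp: atLeast0LessThan)
  have "\<forall>s\<in>S. \<exists>c. x * v s = (\<Sum>t\<in>S. of_int (c t) * v t)"
    using stable by (auto simp: int_span_def)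
  then obtain c where c: "\<And>s. s \<in> S \<Longrightarrow> x * v s = (\<Sum>t\<in>S. of_int (c s t) * v t)"
    by (rule bchoice[THEN exE]) blast
  have "s \<in> h ` {..<card S}"
    using bij_betw_imp_surj_on[OF h] nz(1) by simp
  then obtain k where k: "k < card S" "h k = s"
    by auto
  show ?thesis
  proof (rule algebraic_int_if_eigen[where v = "\<lambda>i. v (h i)"])
    fix i assume "i < card S"
    then have "h i \<in> S" using h by (auto simp: bij_betw_def)
    from c[OF this] show "x * v (h i) = (\<Sum>j<card S. of_int (c (h i) (h j)) * v (h j))"
      by (simp add: sum.reindex_bij_betw[OF h, of "\<lambda>t. of_int (c (h i) t) * v t"])
  next
    show "k < card S" "v (h k) \<noteq> 0" using k nz by simp_all
  qed
qed

lemma algebraic_int_power_reduce: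
  fixes a :: complex
  assumes "algebraic_int a"
  obtains k c where "k > 0" "a ^ k = (\<Sum>i<k. of_int (c i) * a ^ i)"
proof -
  from assms obtain p where p: "poly (map_poly of_int p) a = 0" "lead_coeff p = 1"
    by (auto simp: algebraic_int_altdef_ipoly)
  define k where "k = degree p"
  have "0 = (\<Sum>i\<le>k. of_int (coeff p i) * a ^ i)"
    using p(1) by (simp add: poly_altdef k_def)
  also have "\<dots> = a ^ k + (\<Sum>i<k. of_int (coeff p i) * a ^ i)"
    using p(2) by (simp add: k_def lessThan_Suc_atMost [symmetric])
  finally have eq: "a ^ k = (\<Sum>i<k. of_int (- coeff p i) * a ^ i)"
    by (simp add: sum_negf add_eq_0_iff)
  \<comment> \<open>For k = 0 the equation would read 1 = 0.\<close>
  then have "k > 0"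
    by (cases k) auto
  from that[OF this eq] show ?thesis .
qed

text \<open>Monic equations of degrees k and l for a and b make the finitely generated module
  spanned by a^i b^j with i < k, j < l stable under a and under b, hence under a + b and a * b. It
  contains 1, so the determinant trick applies.\<close>

lemma algebraic_int_add_mult:
  fixes a b :: complex
  assumes "algebraic_int a" "algebraic_int b"
  shows "algebraic_int (a + b)" "algebraic_int (a * b)"
proof -
  obtain k c where k: "k > 0" and c: "a ^ k = (\<Sum>i<k. of_int (c i) * a ^ i)"
    using algebraic_int_power_reduce[OF assms(1)] .
  obtain l d where l: "l > 0" and d: "b ^ l = (\<Sum>i<l. of_int (d i) * b ^ i)"
    using algebraic_int_power_reduce[OF assms(2)] .
  define S where "S = {..<k} \<times> {..<l}"
  define v where "v = (\<lambda>(i, j). a ^ i * b ^ j)"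
  have fin: "finite S" by (simp add: S_def)
  have one: "(0, 0) \<in> S" "v (0, 0) \<noteq> 0" using k l by (auto simp: S_def v_def)
  have base: "a ^ i * b ^ j \<in> int_span S v" if "i < k" "j < l" for i j
    using int_span_base[OF fin, of "(i, j)" v] that by (simp add: S_def v_def)
  have ma: "a * v s \<in> int_span S v" if "s \<in> S" for s
  proof -
    obtain i j where s: "s = (i, j)" "i < k" "j < l" using \<open>s \<in> S\<close> by (auto simp: S_def)
    have eq: "a * v s = a ^ Suc i * b ^ j" by (simp add: s v_def)
    show ?thesis
    proof (cases "Suc i < k")
      case True
      then show ?thesis unfolding eq using s by (intro base) auto
    next
      case False
      have "Suc i = k" using False s by simp
      have "a * v s = (\<Sum>i<k. of_int (c i) * a ^ i) * b ^ j"
        unfolding eq \<open>Suc i = k\<close> c ..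
      also have "\<dots> = (\<Sum>i<k. of_int (c i) * (a ^ i * b ^ j))"
        by (simp only: sum_distrib_right mult.assoc)
      also have "\<dots> \<in> int_span S v"
        using s by (intro int_span_sum int_span_mult_int base) auto
      finally show ?thesis .
    qed
  qed
  have mb: "b * v s \<in> int_span S v" if "s \<in> S" for s
  proof -
    obtain i j where s: "s = (i, j)" "i < k" "j < l" using \<open>s \<in> S\<close> by (auto simp: S_def)
    have eq: "b * v s = a ^ i * b ^ Suc j" by (simp add: s v_def)
    show ?thesis
    proof (cases "Suc j < l")
      case True
      then show ?thesis unfolding eq using s by (intro base) auto
    next
      case False
      have "Suc j = l" using False s by simp
      have "b * v s = a ^ i * (\<Sum>j<l. of_int (d j) * b ^ j)"
        unfolding eq \<open>Suc j = l\<close> d ..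
      also have "\<dots> = (\<Sum>j<l. of_int (d j) * (a ^ i * b ^ j))"
        by (simp only: sum_distrib_left mult.left_commute)
      also have "\<dots> \<in> int_span S v"
        using s by (intro int_span_sum int_span_mult_int base) auto
      finally show ?thesis .
    qed
  qed
  show "algebraic_int (a + b)"
  proof (rule algebraic_int_if_int_span_stable[where v = v, OF fin one])
    show "(a + b) * v s \<in> int_span S v" if "s \<in> S" for s
      unfolding distrib_right using that by (intro int_span_add ma mb)
  qed
  show "algebraic_int (a * b)"
  proof (rule algebraic_int_if_int_span_stable[where v = v, OF fin one])
    show "a * b * v s \<in> int_span S v" if "s \<in> S" for s
      unfolding mult.assoc by (rule int_span_stable[OF ma mb[OF that]])
  qed
qed

section \<open>Evaluation of integer polynomials at a complex number\<close>

definition zeval :: "complex \<Rightarrow> int poly \<Rightarrow> complex" where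
  "zeval x p = poly (map_poly of_int p) x"

lemma zeval_simps [simp]:
  "zeval x 0 = 0" "zeval x 1 = 1"
  "zeval x (p + q) = zeval x p + zeval x q"
  "zeval x (p - q) = zeval x p - zeval x q"
  "zeval x (- p) = - zeval x p"
  "zeval x (p * q) = zeval x p * zeval x q"
  "zeval x (p ^ k) = zeval x p ^ k"
  "zeval x (smult c p) = of_int c * zeval x p"
  "zeval x (pCons c p) = of_int c + x * zeval x p"
  "zeval x (sum g I) = (\<Sum>i\<in>I. zeval x (g i))"
  by (simp_all add: zeval_def of_int_hom.map_poly_pCons_hom of_int_poly_hom.hom_add
      of_int_poly_hom.hom_minus of_int_poly_hom.hom_uminus of_int_poly_hom.hom_mult
      of_int_poly_hom.hom_power of_int_poly_hom.hom_sum of_int_hom.map_poly_hom_smult poly_sum)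

lemma algebraic_int_zeval: "algebraic_int x \<Longrightarrow> algebraic_int (zeval x p)"
  by (induction p) (auto intro: algebraic_int_add_mult)

lemma int_adjoin_zeval: "int_adjoin x = range (zeval x)"
  by (simp add: int_adjoin_def zeval_def[abs_def])

section \<open>The ring \<open>\<int>[\<theta>]\<close> and its field of fractions\<close>

text \<open>Pseudo-division multiplies the dividend by a power of the leading coefficient of f,
  which is 1 here.\<close>

lemma monic_division:
  fixes f g :: "int poly"
  assumes "lead_coeff f = 1"
  obtains q r where "g = f * q + r" "r = 0 \<or> degree r < degree f"
proof -
  have "f \<noteq> 0" using assms by auto
  moreover obtain q r where "pseudo_divmod g f = (q, r)" by (cases "pseudo_divmod g f")
  ultimately have "g = f * q + r" "r = 0 \<or> degree r < degree f"
    using pseudo_divmod[of f g q r] assms by auto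
  then show ?thesis by (rule that)
qed

definition reval :: "complex \<Rightarrow> rat poly \<Rightarrow> complex" where
  "reval x p = poly (map_poly of_rat p) x"

lemma reval_simps [simp]:
  "reval x 0 = 0" "reval x 1 = 1"
  "reval x (p + q) = reval x p + reval x q"
  "reval x (p * q) = reval x p * reval x q"
  "reval x (pCons c p) = of_rat c + x * reval x p"
proof -
  interpret h: map_poly_comm_ring_hom "of_rat :: rat \<Rightarrow> complex" ..
  show "reval x 0 = 0" "reval x 1 = 1"
    "reval x (p + q) = reval x p + reval x q"
    "reval x (p * q) = reval x p * reval x q"
    "reval x (pCons c p) = of_rat c + x * reval x p"
    by (simp_all add: reval_def of_rat_hom.map_poly_pCons_hom h.hom_add h.hom_mult)
qed

lemma reval_of_int_poly [simp]: "reval x (map_poly of_int p) = zeval x p"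
  by (simp add: reval_def zeval_def map_poly_map_poly o_def)

locale monic_root =
  fixes f :: "int poly" and \<theta> :: complex
  assumes monic: "lead_coeff f = 1"
    and irred: "irreducible (map_poly rat_of_int f)"
    and root: "zeval \<theta> f = 0"
begin

text \<open>Over the field of rationals an irreducible polynomial that does not divide g is coprime
  to it; evaluating a Bezout identity at \<theta> removes the term with f. So nonzero elements of
  Q[\<theta>] are invertible.\<close>

lemma rat_bezout:
  assumes "\<not> map_poly rat_of_int f dvd g"
  obtains v where "reval \<theta> v * reval \<theta> g = 1"
proof -
  let ?f = "map_poly rat_of_int f"
  have "prime_elem ?f"
    using irred by (rule irreducible_imp_prime_elem_gcd)
  then have "gcd ?f g = 1"
    using assms prime_elem_imp_coprime[of ?f g] by simp
  then have "fst (bezout_coefficients ?f g) * ?f + snd (bezout_coefficients ?f g) * g = 1"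
    by (simp add: bezout_coefficients_fst_snd)
  from arg_cong[OF this, of "reval \<theta>"] show ?thesis
    by (intro that[of "snd (bezout_coefficients ?f g)"]) (simp add: root)
qed

lemma zeval_eq_0_imp_rat_dvd:
  assumes "zeval \<theta> g = 0"
  shows "map_poly rat_of_int f dvd map_poly rat_of_int g"
proof (rule ccontr)
  assume "\<not> ?thesis"
  then obtain v where "reval \<theta> v * reval \<theta> (map_poly of_int g) = 1"
    by (rule rat_bezout)
  then show False using assms by simp
qed

lemma zeval_eq_0_degree:
  assumes "zeval \<theta> g = 0" "degree g < degree f"
  shows "g = 0"
proof (rule ccontr)
  assume "g \<noteq> 0"
  then have "map_poly rat_of_int g \<noteq> 0" by simp
  from dvd_imp_degree_le[OF zeval_eq_0_imp_rat_dvd[OF assms(1)] this]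
  show False using assms(2) by simp
qed

lemma zeval_eq_0_dvd:
  assumes "zeval \<theta> g = 0"
  shows "f dvd g"
proof -
  obtain q r where g: "g = f * q + r" and r: "r = 0 \<or> degree r < degree f"
    using monic_division[OF monic] .
  have "zeval \<theta> r = 0" using assms by (simp add: g root)
  with r zeval_eq_0_degree[of r] have "r = 0" by auto
  with g show ?thesis by simp
qed

text \<open>A factor that is a unit over Q is constant, and a constant dividing a monic polynomial
  over Z is a unit.\<close>

lemma irreducible_int: "irreducible f"
proof (rule irreducibleI)
  show "f \<noteq> 0" using monic by auto
  show "\<not> f dvd 1"
  proof
    assume "f dvd 1"
    then obtain h where "f * h = 1" by (metis dvdE)
    then have "map_poly rat_of_int f * map_poly of_int h = 1"
      by (metis of_int_poly_hom.hom_mult of_int_poly_hom.hom_one)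
    then have "map_poly rat_of_int f dvd 1" by (metis dvd_triv_left)
    with irreducible_not_unit[OF irred] show False by blast
  qed
next
  fix g h assume f: "f = g * h"
  have unit: "u dvd 1" if "u dvd f" "map_poly rat_of_int u dvd 1" for u
  proof -
    have "degree u = 0"
      using that(2) by (simp add: poly_dvd_1)
    then obtain c where u: "u = [:c:]" by (auto elim: degree_eq_zeroE)
    from that(1) obtain w where "f = [:c:] * w" unfolding u by (elim dvdE)
    then have "c * lead_coeff w = 1" using monic by (auto simp: lead_coeff_smult split: if_splits)
    then have "c dvd 1" by (metis dvd_triv_left)
    then show ?thesis by (simp add: u const_poly_dvd_1)
  qed
  have "map_poly rat_of_int f = map_poly of_int g * map_poly of_int h"
    by (simp add: f of_int_poly_hom.hom_mult)
  with irred have "map_poly rat_of_int g dvd 1 \<or> map_poly rat_of_int h dvd 1"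
    by (rule irreducibleD)
  with unit[of g] unit[of h] show "g dvd 1 \<or> h dvd 1" by (auto simp: f)
qed

text \<open>An explicit form of the field Q(\<theta>): since \<theta> is algebraic, integer
  denominators suffice.\<close>

definition fractions :: "complex set" where
  "fractions = {zeval \<theta> q / of_int N |q N. N \<noteq> 0}"

lemma fractionsI: "N \<noteq> 0 \<Longrightarrow> x = zeval \<theta> q / of_int N \<Longrightarrow> x \<in> fractions"
  by (auto simp: fractions_def)

lemma fractionsE:
  assumes "x \<in> fractions"
  obtains q N where "N \<noteq> 0" "x = zeval \<theta> q / of_int N"
  using assms by (auto simp: fractions_def)

lemma fractions_add: "x \<in> fractions \<Longrightarrow> y \<in> fractions \<Longrightarrow> x + y \<in> fractions"
proof (elim fractionsE)
  fix q M r N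
  assume *: "M \<noteq> 0" "x = zeval \<theta> q / of_int M" "N \<noteq> 0" "y = zeval \<theta> r / of_int N"
  then show ?thesis
    by (intro fractionsI[of "M * N" _ "smult N q + smult M r"]) (auto simp: field_simps)
qed

lemma fractions_mult: "x \<in> fractions \<Longrightarrow> y \<in> fractions \<Longrightarrow> x * y \<in> fractions"
proof (elim fractionsE)
  fix q M r N
  assume *: "M \<noteq> 0" "x = zeval \<theta> q / of_int M" "N \<noteq> 0" "y = zeval \<theta> r / of_int N"
  then show ?thesis
    by (intro fractionsI[of "M * N" _ "q * r"]) auto
qed

lemma zeval_fractions: "zeval \<theta> q \<in> fractions"
  by (rule fractionsI[of 1]) auto

lemma fractions_of_int: "of_int k \<in> fractions"
  using zeval_fractions[of "[:k:]"] by simp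

lemma fractions_root: "\<theta> \<in> fractions"
  using zeval_fractions[of "[:0, 1:]"] by simp

lemma fractions_of_rat: "of_rat c \<in> fractions"
proof -
  obtain a b where "b > 0" "c = of_int a / of_int b"
    by (metis quotient_of_div quotient_of_denom_pos surj_pair)
  then show ?thesis
    by (intro fractionsI[of b _ "[:a:]"]) (auto simp: of_rat_divide)
qed

lemma reval_fractions: "reval \<theta> v \<in> fractions"
  by (induction v) (use fractions_of_int[of 0] in \<open>auto intro: fractions_add fractions_mult fractions_of_rat fractions_root\<close>)

lemma fractions_inverse:
  assumes "x \<in> fractions" "x \<noteq> 0"
  shows "inverse x \<in> fractions"
proof -
  obtain q N where *: "N \<noteq> 0" "x = zeval \<theta> q / of_int N"
    using assms(1) by (rule fractionsE)
  have "\<not> map_poly rat_of_int f dvd map_poly rat_of_int q"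
  proof
    assume "map_poly rat_of_int f dvd map_poly rat_of_int q"
    then obtain h where "map_poly rat_of_int q = map_poly of_int f * h" by (elim dvdE)
    from arg_cong[OF this, of "reval \<theta>"] show False using assms(2) * by (simp add: root)
  qed
  then obtain v where "reval \<theta> v * zeval \<theta> q = 1"
    using rat_bezout[of "map_poly of_int q"] by auto
  then have "x * (of_int N * reval \<theta> v) = 1"
    using * by (simp add: mult.commute)
  then have "inverse x = of_int N * reval \<theta> v"
    by (rule inverse_unique)
  then show ?thesis by (simp add: fractions_mult fractions_of_int reval_fractions)
qed

lemma rat_adjoin_eq_fractions: "rat_adjoin \<theta> = fractions"
proof
  have "complex_subfield fractions"
    unfolding complex_subfield_def
  proof (intro conjI ballI impI)
    fix x y assume xy: "x \<in> fractions" "y \<in> fractions"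
    from fractions_add[OF xy(1) fractions_mult[OF fractions_of_int[of "-1"] xy(2)]]
    show "x - y \<in> fractions" by simp
  qed (use fractions_of_int[of 0] fractions_of_int[of 1] in
        \<open>auto intro: fractions_add fractions_mult fractions_inverse\<close>)
  then show "rat_adjoin \<theta> \<subseteq> fractions"
    using fractions_root by (auto simp: rat_adjoin_def)
next
  have "zeval \<theta> q / of_int N \<in> F"
    if F: "complex_subfield F" "\<theta> \<in> F" and N: "N \<noteq> 0" for F q N
  proof -
    have basic: "0 \<in> F" "1 \<in> F" and closed: "\<And>x y. x \<in> F \<Longrightarrow> y \<in> F \<Longrightarrow> x + y \<in> F"
      "\<And>x y. x \<in> F \<Longrightarrow> y \<in> F \<Longrightarrow> x - y \<in> F" "\<And>x y. x \<in> F \<Longrightarrow> y \<in> F \<Longrightarrow> x * y \<in> F"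
      "\<And>x. x \<in> F \<Longrightarrow> x \<noteq> 0 \<Longrightarrow> inverse x \<in> F"
      using F(1) by (auto simp: complex_subfield_def)
    have of_int: "of_int k \<in> F" for k
      by (induction k rule: int_induct[of _ 0]) (auto intro: basic closed)
    have "zeval \<theta> q \<in> F"
      by (induction q) (auto intro: basic closed of_int F(2))
    moreover have "inverse (of_int N) \<in> F"
      using N by (intro closed of_int) auto
    ultimately show ?thesis
      unfolding divide_inverse by (rule closed)
  qed
  then show "fractions \<subseteq> rat_adjoin \<theta>"
    by (auto simp: rat_adjoin_def fractions_def)
qed

lemma algebraic_int_theta: "algebraic_int \<theta>"
  using root monic by (auto simp: algebraic_int_altdef_ipoly zeval_def)

lemma algebraic_int_zeval_root: "algebraic_int (zeval \<theta> q)"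
  by (rule algebraic_int_zeval[OF algebraic_int_theta])

end

section \<open>Maximality of \<open>\<int>[\<theta>]\<close> at a prime\<close>

text \<open>By downward induction p divides every coefficient of \<alpha>: at degree w + i the
  product has \<open>coeff \<alpha> i\<close>, because w is monic, plus terms with higher
  coefficients of \<alpha>, while 1 has coefficient 0 there. Then p would divide the constant term
  1.\<close>

lemma monic_not_unit_mod:
  fixes w :: "int poly" and p :: int
  assumes "prime p" "lead_coeff w = 1" "degree w > 0"
  shows "1 \<noteq> w * \<alpha> + smult p \<beta>"
proof
  assume eq: "1 = w * \<alpha> + smult p \<beta>"
  have "p dvd coeff \<alpha> i" for i
  proof (induction "degree \<alpha> - i" arbitrary: i rule: less_induct)
    case less
    show ?case
    proof (cases "i \<le> degree \<alpha>")
      case False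
      then show ?thesis by (simp add: coeff_eq_0)
    next
      case True
      let ?n = "degree w + i"
      have "coeff (w * \<alpha>) ?n = (\<Sum>j\<le>?n. coeff w j * coeff \<alpha> (?n - j))"
        by (rule coeff_mult)
      also have "\<dots> = coeff w (degree w) * coeff \<alpha> (?n - degree w) +
          (\<Sum>j\<in>{..?n} - {degree w}. coeff w j * coeff \<alpha> (?n - j))"
        by (subst sum.remove[of _ "degree w"]) auto
      finally have 1: "coeff \<alpha> i = coeff (w * \<alpha>) ?n -
          (\<Sum>j\<in>{..?n} - {degree w}. coeff w j * coeff \<alpha> (?n - j))"
        using assms(2) by simp
      have "p dvd (\<Sum>j\<in>{..?n} - {degree w}. coeff w j * coeff \<alpha> (?n - j))"
      proof (rule dvd_sum)
        fix j assume j: "j \<in> {..?n} - {degree w}"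
        show "p dvd coeff w j * coeff \<alpha> (?n - j)"
        proof (cases "j < degree w")
          case True
          then have "i < ?n - j" by linarith
          with \<open>i \<le> degree \<alpha>\<close> have "degree \<alpha> - (?n - j) < degree \<alpha> - i \<or> degree \<alpha> < ?n - j"
            by linarith
          then have "p dvd coeff \<alpha> (?n - j)"
            using less by (auto simp: coeff_eq_0)
          then show ?thesis by simp
        next
          case False
          with j show ?thesis by (simp add: coeff_eq_0)
        qed
      qed
      moreover have "coeff (1 :: int poly) ?n = 0"
        using assms(3) by simp
      then have "coeff (w * \<alpha>) ?n = - (p * coeff \<beta> ?n)"
        unfolding eq by simp
      ultimately show ?thesis
        unfolding 1 by (intro dvd_diff) auto
    qed
  qed
  then have "p dvd coeff (w * \<alpha> + smult p \<beta>) 0"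
    by (simp add: coeff_mult)
  then have "p dvd 1" by (simp flip: eq)
  with assms(1) show False by (simp add: not_prime_unit)
qed

text \<open>In Z[X]/(w, p) the element d is a unit by the first equation and nilpotent by the
  second, so this ring is zero.\<close>

lemma unit_mod_power:
  fixes d w x :: "int poly"
  assumes "1 = w * \<alpha> + d * \<gamma> + smult p \<beta>" and "d ^ k = w * \<sigma> + smult p \<tau>"
  obtains \<alpha>' \<beta>' where "1 = w * \<alpha>' + smult p \<beta>'"
proof -
  have "\<exists>\<alpha> \<beta>. (d * \<gamma>) ^ j = 1 + w * \<alpha> + smult p \<beta>" for j
  proof (induction j)
    case 0
    show ?case by (intro exI[of _ 0]) simp
  next
    case (Suc j)
    then obtain \<alpha>' \<beta>' where *: "(d * \<gamma>) ^ j = 1 + w * \<alpha>' + smult p \<beta>'" by blast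
    have dg: "d * \<gamma> = 1 - w * \<alpha> - smult p \<beta>" using assms(1) by (simp add: algebra_simps)
    have "(d * \<gamma>) ^ Suc j = (1 - w * \<alpha> - smult p \<beta>) * (1 + w * \<alpha>' + smult p \<beta>')"
      using * dg by simp
    also have "\<dots> = 1 + w * ((1 - w * \<alpha> - smult p \<beta>) * \<alpha>' - \<alpha>) +
        smult p ((1 - w * \<alpha> - smult p \<beta>) * \<beta>' - \<beta>)"
      by (simp add: algebra_simps smult_diff_right smult_add_right)
    finally show ?case by blast
  qed
  then obtain \<alpha>' \<beta>' where "(d * \<gamma>) ^ k = 1 + w * \<alpha>' + smult p \<beta>'" by blast
  moreover have "(d * \<gamma>) ^ k = w * (\<sigma> * \<gamma> ^ k) + smult p (\<tau> * \<gamma> ^ k)"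
    by (simp add: power_mult_distrib assms(2) algebra_simps)
  ultimately have "1 = w * (\<sigma> * \<gamma> ^ k - \<alpha>') + smult p (\<tau> * \<gamma> ^ k - \<beta>')"
    by (simp add: algebra_simps smult_diff_right)
  then show ?thesis by (rule that)
qed

context monic_root
begin

lemma zeval_eq_reduce:
  obtains r where "zeval \<theta> r = zeval \<theta> q" "r = 0 \<or> degree r < degree f"
proof -
  obtain t r where "q = f * t + r" "r = 0 \<or> degree r < degree f"
    using monic_division[OF monic] .
  then show ?thesis by (intro that[of r]) (simp_all add: root)
qed

lemma double_root_not_maximal:
  assumes p: "prime p" and deg: "degree f \<ge> 2"
    and dvd: "p\<^sup>2 dvd poly f a" "p\<^sup>2 dvd poly (pderiv f) a"
  shows "int_adjoin \<theta> \<noteq> ring_of_integers (rat_adjoin \<theta>)"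
proof -
  have p0: "p \<noteq> 0" using p by auto
  define q where "q = synthetic_div f a"
  define g where "g = synthetic_div q a"
  have f_q: "f = [:-a, 1:] * q + [:poly f a:]"
    unfolding q_def by (rule synthetic_div_correct'[symmetric])
  have q_g: "q = [:-a, 1:] * g + [:poly q a:]"
    unfolding g_def by (rule synthetic_div_correct'[symmetric])
  have "pderiv f = [:-a, 1:] * pderiv q + q"
    by (subst f_q, subst pderiv_add, subst pderiv_mult) (simp add: pderiv_pCons)
  then have q_a: "poly q a = poly (pderiv f) a"
    by simp
  obtain u v where u: "poly f a = p\<^sup>2 * u" and v: "poly q a = p\<^sup>2 * v"
    using dvd unfolding q_a by (elim dvdE)
  define h where "h = [:-a, 1:] * g"
  have deg_q: "degree q = degree f - 1" by (simp add: q_def degree_synthetic_div)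
  \<comment> \<open>Subtracting a constant from q does not touch its leading coefficient, as q has
    degree at least 1. So h has leading coefficient 1 in degree n - 1, where n is the degree of f,
    and this is what will keep \<beta> out of Z[\<theta>].\<close>
  have "coeff f (degree f) = coeff q (degree f - 1)"
    using deg deg_q by (subst f_q) (simp add: coeff_pCons coeff_eq_0 split: nat.splits)
  then have "coeff q (degree f - 1) = 1" using monic by simp
  moreover have h_q: "h = q - [:poly q a:]" using q_g by (simp add: h_def)
  ultimately have coeff_h: "coeff h (degree f - 1) = 1" and deg_h: "degree h < degree f"
    using deg deg_q by (auto simp: coeff_pCons split: nat.splits intro!: degree_diff_less)
  define \<beta> where "\<beta> = zeval \<theta> h / of_int p"
  have "h\<^sup>2 = g * (f - smult (p\<^sup>2) ([:u:] + smult v [:-a, 1:]))"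
  proof -
    have "h\<^sup>2 = g * ([:-a, 1:] * ([:-a, 1:] * g))"
      by (simp only: h_def power2_eq_square mult_ac)
    also have "[:-a, 1:] * ([:-a, 1:] * g) = f - smult (p\<^sup>2) ([:u:] + smult v [:-a, 1:])"
    proof -
      have "[:-a, 1:] * ([:-a, 1:] * g) = [:-a, 1:] * (q - [:poly q a:])"
        by (simp only: h_q h_def[symmetric])
      also have "\<dots> = (f - [:poly f a:]) - [:-a, 1:] * [:poly q a:]"
        unfolding right_diff_distrib using f_q by (metis add_diff_cancel_right')
      finally show ?thesis by (simp add: u v algebra_simps)
    qed
    finally show ?thesis .
  qed
  from arg_cong[OF this, of "zeval \<theta>"]
  have "(zeval \<theta> h)\<^sup>2 = - (of_int p)\<^sup>2 * zeval \<theta> (g * ([:u:] + smult v [:-a, 1:]))"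
    by (simp add: root algebra_simps del: mult_pCons_left mult_pCons_right)
  then have "\<beta>\<^sup>2 = zeval \<theta> (- (g * ([:u:] + smult v [:-a, 1:])))"
    using p0 by (simp add: \<beta>_def power_divide field_simps)
  then have "algebraic_int (\<beta>\<^sup>2)"
    by (simp only: algebraic_int_zeval_root)
  then have "algebraic_int \<beta>"
    by (rule algebraic_int_root[of _ "monom 1 2"]) (auto simp: poly_monom degree_monom_eq)
  moreover have "\<beta> \<in> rat_adjoin \<theta>"
    unfolding rat_adjoin_eq_fractions \<beta>_def using p0 by (intro fractionsI[of p]) auto
  moreover have "\<beta> \<notin> int_adjoin \<theta>"
  proof
    assume "\<beta> \<in> int_adjoin \<theta>"
    then obtain s where "\<beta> = zeval \<theta> s" by (auto simp: int_adjoin_zeval)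
    then obtain r where r: "\<beta> = zeval \<theta> r" "r = 0 \<or> degree r < degree f"
      using zeval_eq_reduce[of s] by metis
    have "h - smult p r = 0"
    proof (rule zeval_eq_0_degree)
      show "zeval \<theta> (h - smult p r) = 0"
        using r(1) p0 by (simp add: \<beta>_def field_simps)
      show "degree (h - smult p r) < degree f"
        using deg_h r(2) deg by (intro degree_diff_less) auto
    qed
    then have "h = smult p r" by simp
    then have "p * coeff r (degree f - 1) = 1" using coeff_h by simp
    then have "p dvd 1" by (metis dvd_triv_left)
    with p show False by (simp add: not_prime_unit)
  qed
  ultimately show ?thesis by (auto simp: ring_of_integers_def)
qed

text \<open>For nonzero p this is the preimage in Z[X] of the intersection of p O with Z[\<theta>],
  where O is the ring of all algebraic integers.\<close>

definition denom_ideal :: "int \<Rightarrow> int poly set" where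
  "denom_ideal p = {h. algebraic_int (zeval \<theta> h / of_int p)}"

lemma denom_ideal_add: "h \<in> denom_ideal p \<Longrightarrow> k \<in> denom_ideal p \<Longrightarrow> h + k \<in> denom_ideal p"
  unfolding denom_ideal_def by (auto simp: add_divide_distrib intro: algebraic_int_add_mult)

lemma denom_ideal_mult: "h \<in> denom_ideal p \<Longrightarrow> q * h \<in> denom_ideal p"
  using algebraic_int_add_mult(2)[OF algebraic_int_zeval_root[of q], of "zeval \<theta> h / of_int p"]
  unfolding denom_ideal_def by simp

lemma denom_ideal_smult: "p \<noteq> 0 \<Longrightarrow> smult p h \<in> denom_ideal p"
  unfolding denom_ideal_def by (simp add: algebraic_int_zeval_root)

lemma denom_ideal_root: "f \<in> denom_ideal p"
  by (simp add: denom_ideal_def root)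

text \<open>Modulo p the coefficients form a field, so an element of degree below N that is not
  divisible by p could be made monic without leaving the ideal, against the minimality of N. The
  induction strips one top term divisible by p at a time.\<close>

lemma denom_ideal_low_degree:
  assumes p: "prime p" and r: "r \<in> denom_ideal p" "\<And>i. i \<ge> N \<Longrightarrow> coeff r i = 0"
    and min: "\<And>h. h \<in> denom_ideal p \<Longrightarrow> lead_coeff h = 1 \<Longrightarrow> N \<le> degree h"
  shows "\<exists>r'. r = smult p r'"
  using r min
proof (induction N arbitrary: r)
  case 0
  then have "r = smult p 0" by (simp add: poly_eq_iff)
  then show ?case by blast
next
  case (Suc N)
  have p0: "p \<noteq> 0" using p by auto
  define c where "c = coeff r N"
  show ?case
  proof (cases "p dvd c")
    case True
    then obtain c' where c': "c = p * c'" by (elim dvdE)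
    have "\<exists>r'. r + smult p (monom (- c') N) = smult p r'"
    proof (rule Suc.IH)
      show "r + smult p (monom (- c') N) \<in> denom_ideal p"
        using Suc.prems(1) p0 by (intro denom_ideal_add denom_ideal_smult)
      show "coeff (r + smult p (monom (- c') N)) i = 0" if "i \<ge> N" for i
        using that Suc.prems(2)[of i] c' by (cases "i = N") (auto simp: c_def)
      show "N \<le> degree h" if "h \<in> denom_ideal p" "lead_coeff h = 1" for h
        using Suc.prems(3)[OF that] by simp
    qed
    then obtain r' where "r + smult p (monom (- c') N) = smult p r'" by blast
    then have "r = smult p (r' - monom (- c') N)" by (simp add: smult_diff_right algebra_simps)
    then show ?thesis by blast
  next
    case False
    then have "coprime c p" using p by (metis coprime_commute prime_imp_coprime)
    then obtain u v where uv: "u * c + v * p = 1" by (metis bezout_int coprime_imp_gcd_eq_1)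
    \<comment> \<open>The Bezout coefficients turn the top coefficient into u c + v p = 1.\<close>
    define h where "h = [:u:] * r + smult p (monom v N)"
    have "h \<in> denom_ideal p" unfolding h_def
      by (intro denom_ideal_add denom_ideal_mult denom_ideal_smult p0 Suc.prems)
    moreover have cN: "coeff h N = 1" using uv by (simp add: h_def c_def mult.commute)
    have "coeff h i = 0" if "i > N" for i
      using Suc.prems(2)[of i] that by (simp add: h_def)
    then have "degree h \<le> N" by (simp add: degree_le)
    with cN have "degree h = N" by (metis le_antisym le_degree zero_neq_one)
    ultimately show ?thesis using Suc.prems(3)[of h] cN by auto
  qed
qed

text \<open>
  A monic equation for \<open>x = u(\<theta>) / y(\<theta>)\<close>, cleared of denominators and lifted to \<open>\<int>[X]\<close>.
\<close>

lemma algebraic_int_power_relation: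
  assumes "algebraic_int x"
  obtains k c where "k > 0"
    "\<And>y u :: int poly. zeval \<theta> u = zeval \<theta> y * x \<Longrightarrow>
      f dvd u ^ k - (\<Sum>i<k. smult (c i) (y ^ (k - i) * u ^ i))"
proof -
  obtain k c where k: "k > 0" and c: "x ^ k = (\<Sum>i<k. of_int (c i) * x ^ i)"
    using algebraic_int_power_reduce[OF assms] .
  show ?thesis
  proof (rule that[OF k])
    fix y u assume *: "zeval \<theta> u = zeval \<theta> y * x"
    show "f dvd u ^ k - (\<Sum>i<k. smult (c i) (y ^ (k - i) * u ^ i))"
    proof (rule zeval_eq_0_dvd)
      have "zeval \<theta> u ^ k = zeval \<theta> y ^ k * (\<Sum>i<k. of_int (c i) * x ^ i)"
        by (simp only: * power_mult_distrib c)
      also have "\<dots> = (\<Sum>i<k. of_int (c i) * (zeval \<theta> y ^ (k - i) * zeval \<theta> u ^ i))"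
        unfolding sum_distrib_left
        by (intro sum.cong) (simp_all add: * power_mult_distrib mult_ac flip: power_add)
      finally show "zeval \<theta> (u ^ k - (\<Sum>i<k. smult (c i) (y ^ (k - i) * u ^ i))) = 0"
        by simp
    qed
  qed
qed

text \<open>
  The hypothesis on \<open>d\<close> and \<open>w\<close> says that they are not coprime modulo \<open>p\<close>.
\<close>

lemma simple_root_criterion:
  assumes p: "prime p"
    and crit: "\<And>d w r. f = d * w + smult p r \<Longrightarrow>
      \<nexists>\<alpha> \<beta> \<gamma>. 1 = w * \<alpha> + d * \<gamma> + smult p \<beta> \<Longrightarrow>
      \<exists>a. p dvd poly w a \<and> \<not> p\<^sup>2 dvd poly f a"
    and h: "algebraic_int (zeval \<theta> h / of_int p)"
  shows "\<exists>h'. zeval \<theta> h = of_int p * zeval \<theta> h'"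
proof -
  have p0: "p \<noteq> 0" using p by auto
  define M where "M = {d \<in> denom_ideal p. lead_coeff d = 1}"
  have "f \<in> M" using denom_ideal_root monic by (simp add: M_def)
  then obtain d where d: "d \<in> M" and d_min: "\<And>e. e \<in> M \<Longrightarrow> degree d \<le> degree e"
    using ex_has_least_nat[of "\<lambda>d. d \<in> M" f degree] by blast
  have dJ: "d \<in> denom_ideal p" and d_monic: "lead_coeff d = 1" using d by (auto simp: M_def)
  have low: "\<exists>r'. r = smult p r'" if "r \<in> denom_ideal p" "r = 0 \<or> degree r < degree d" for r
  proof (rule denom_ideal_low_degree[OF p that(1)])
    show "coeff r i = 0" if "i \<ge> degree d" for i
      using that \<open>r = 0 \<or> degree r < degree d\<close> by (auto simp: coeff_eq_0)
    show "degree d \<le> degree e" if "e \<in> denom_ideal p" "lead_coeff e = 1" for e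
      using that d_min by (simp add: M_def)
  qed
  have remainder: "r \<in> denom_ideal p" if "g = e * q + r" "g \<in> denom_ideal p" "e \<in> denom_ideal p" for g e q r
  proof -
    have "r = g + (- q) * e" using that(1) by (simp add: mult.commute)
    also have "\<dots> \<in> denom_ideal p" by (intro denom_ideal_add denom_ideal_mult that)
    finally show ?thesis .
  qed
  show ?thesis
  proof (cases "degree d < degree f")
    \<comment> \<open>Now no monic element of the ideal has degree below that of f, so the remainder
      of h modulo f is divisible by p.\<close>
    case False
    obtain q r where qr: "h = f * q + r" "r = 0 \<or> degree r < degree f"
      using monic_division[OF monic] .
    have "r \<in> denom_ideal p"
      using remainder[OF qr(1)] h denom_ideal_root by (simp add: denom_ideal_def)
    then obtain r' where "r = smult p r'"
      using low[of r] qr(2) False by auto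
    then have "zeval \<theta> h = of_int p * zeval \<theta> r'" by (simp add: qr(1) root)
    then show ?thesis by blast
  next
    case True
    \<comment> \<open>The remainder of f modulo d lies in the ideal and has degree below that of d,
      so it is divisible by p; this yields the factorisation of f modulo p.\<close>
    obtain w r\<^sub>0 where w: "f = d * w + r\<^sub>0" "r\<^sub>0 = 0 \<or> degree r\<^sub>0 < degree d"
      using monic_division[OF d_monic] .
    obtain r where r: "r\<^sub>0 = smult p r"
      using low[OF remainder[OF w(1) denom_ideal_root dJ] w(2)] by blast
    have f: "f = d * w + smult p r" using w(1) r by simp
    have "degree r\<^sub>0 < degree f" using w(2) True by auto
    then have deg_dw: "degree (d * w) = degree f" and lc_dw: "lead_coeff (d * w) = 1"
    proof -
      have dw: "d * w = f + - r\<^sub>0" using w(1) by simp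
      show 1: "degree (d * w) = degree f"
        unfolding dw using \<open>degree r\<^sub>0 < degree f\<close> by (intro degree_add_eq_left) simp
      show "lead_coeff (d * w) = 1"
        unfolding 1 unfolding dw using \<open>degree r\<^sub>0 < degree f\<close> monic by (simp add: coeff_eq_0)
    qed
    have w_monic: "lead_coeff w = 1" using lc_dw d_monic by (simp add: lead_coeff_mult)
    have w_deg: "degree w > 0"
      using deg_dw True w_monic d_monic by (subst (asm) degree_mult_eq) auto
    have "\<nexists>\<alpha> \<beta> \<gamma>. 1 = w * \<alpha> + d * \<gamma> + smult p \<beta>"
    proof
      assume "\<exists>\<alpha> \<beta> \<gamma>. 1 = w * \<alpha> + d * \<gamma> + smult p \<beta>"
      then obtain \<alpha> \<beta> \<gamma> where unit: "1 = w * \<alpha> + d * \<gamma> + smult p \<beta>" by blast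
      obtain k c where k: "k > 0" and c: "\<And>y u :: int poly.
          zeval \<theta> u = zeval \<theta> y * (zeval \<theta> d / of_int p) \<Longrightarrow>
          f dvd u ^ k - (\<Sum>i<k. smult (c i) (y ^ (k - i) * u ^ i))"
        using algebraic_int_power_relation dJ unfolding denom_ideal_def by blast
      \<comment> \<open>The integral equation of d(\<theta>)/p, with the constant p as denominator,
        puts d^k into (f, p), hence into (w, p). With the assumed comaximality, w would be a unit
        modulo p.\<close>
      have "f dvd d ^ k - (\<Sum>i<k. smult (c i) ([:p:] ^ (k - i) * d ^ i))"
        by (rule c) (use p0 in simp)
      then obtain t where t: "d ^ k - (\<Sum>i<k. smult (c i) ([:p:] ^ (k - i) * d ^ i)) = f * t"
        by (elim dvdE)
      have "(\<Sum>i<k. smult (c i) ([:p:] ^ (k - i) * d ^ i)) =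
          (\<Sum>i<k. smult p (smult (c i) ([:p:] ^ (k - i - 1) * d ^ i)))"
      proof (rule sum.cong)
        fix i assume "i \<in> {..<k}"
        then have "[:p:] ^ (k - i) = [:p:] * [:p:] ^ (k - i - 1)"
          by (simp flip: power_Suc add: Suc_diff_Suc)
        then show "smult (c i) ([:p:] ^ (k - i) * d ^ i) =
            smult p (smult (c i) ([:p:] ^ (k - i - 1) * d ^ i))"
          by (simp add: mult.commute)
      qed simp
      also have "\<dots> = smult p (\<Sum>i<k. smult (c i) ([:p:] ^ (k - i - 1) * d ^ i))"
        by (simp add: smult_sum2)
      finally have "d ^ k = w * (d * t) +
          smult p (r * t + (\<Sum>i<k. smult (c i) ([:p:] ^ (k - i - 1) * d ^ i)))"
        using t unfolding f by (simp add: algebra_simps smult_add_right)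
      from unit_mod_power[OF unit this] obtain \<alpha>' \<beta>' where "1 = w * \<alpha>' + smult p \<beta>'" .
      with monic_not_unit_mod[OF p w_monic w_deg] show False by blast
    qed
    from crit[OF f this] obtain a where a: "p dvd poly w a" "\<not> p\<^sup>2 dvd poly f a" by blast
    obtain w\<^sub>0 where w0: "poly w a = p * w\<^sub>0" using a(1) by (elim dvdE)
    define w' where "w' = synthetic_div w a"
    have w': "w = [:-a, 1:] * w' + [:p * w\<^sub>0:]"
      unfolding w'_def w0[symmetric] by (rule synthetic_div_correct'[symmetric])
    \<comment> \<open>With \<open>z = w'(\<theta>) d(\<theta>) / p\<close> we get \<open>(\<theta> - a) z = s(\<theta>)\<close>, so integrality of \<open>z\<close> puts a power
      of \<open>s\<close> in the ideal \<open>(X - a, f)\<close>, while \<open>f a = - p s(a)\<close>.\<close>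
    define s where "s = - r - smult w\<^sub>0 d"
    have f_s: "f = [:-a, 1:] * (d * w') - smult p s"
    proof -
      have "f = d * ([:-a, 1:] * w' + [:p * w\<^sub>0:]) + smult p r"
        using f w' by simp
      also have "d * (l * w' + [:p * w\<^sub>0:]) + smult p r = l * (d * w') - smult p s" for l
        by (simp add: s_def algebra_simps smult_diff_right)
      finally show ?thesis .
    qed
    have "w' * d \<in> denom_ideal p" by (rule denom_ideal_mult[OF dJ])
    then obtain k c where k: "k > 0" and c: "\<And>y u :: int poly.
        zeval \<theta> u = zeval \<theta> y * (zeval \<theta> (w' * d) / of_int p) \<Longrightarrow>
        f dvd u ^ k - (\<Sum>i<k. smult (c i) (y ^ (k - i) * u ^ i))"
      using algebraic_int_power_relation unfolding denom_ideal_def by blast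
    have "f dvd s ^ k - (\<Sum>i<k. smult (c i) ([:-a, 1:] ^ (k - i) * s ^ i))"
    proof (rule c)
      have "zeval \<theta> ([:-a, 1:] * (d * w') - smult p s) = 0" using root f_s by simp
      then have "zeval \<theta> [:-a, 1:] * (zeval \<theta> d * zeval \<theta> w') = of_int p * zeval \<theta> s"
        unfolding zeval_simps by simp
      then show "zeval \<theta> s = zeval \<theta> [:-a, 1:] * (zeval \<theta> (w' * d) / of_int p)"
        using p0 by (simp add: field_simps del: zeval_simps(9))
    qed
    then obtain v where v: "s ^ k - (\<Sum>i<k. smult (c i) ([:-a, 1:] ^ (k - i) * s ^ i)) = f * v"
      by (elim dvdE)
    have f_a: "poly f a = - p * poly s a" by (subst f_s) simp
    \<comment> \<open>Each summand contains a positive power of X - a because i < k.\<close>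
    have "poly (\<Sum>i<k. smult (c i) ([:-a, 1:] ^ (k - i) * s ^ i)) a = 0"
      by (auto simp: poly_sum intro!: sum.neutral)
    then have "poly s a ^ k = poly f a * poly v a"
      using arg_cong[OF v, of "\<lambda>g. poly g a"] by simp
    then have "p dvd poly s a ^ k" by (simp add: f_a)
    then have "p dvd poly s a" using p prime_dvd_power by blast
    then have "p\<^sup>2 dvd poly f a" by (simp add: f_a power2_eq_square)
    with a(2) show ?thesis by blast
  qed
qed

text \<open>A denominator N is removed one prime at a time: if N = p M, then M x is integral with
  denominator p, so p cancels and M remains.\<close>

lemma int_adjoin_eq_ring_of_integers:
  assumes "\<And>p h. prime p \<Longrightarrow> algebraic_int (zeval \<theta> h / of_int p) \<Longrightarrow>
    \<exists>h'. zeval \<theta> h = of_int p * zeval \<theta> h'"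
  shows "int_adjoin \<theta> = ring_of_integers (rat_adjoin \<theta>)"
proof
  show "int_adjoin \<theta> \<subseteq> ring_of_integers (rat_adjoin \<theta>)"
    by (auto simp: int_adjoin_zeval ring_of_integers_def rat_adjoin_eq_fractions
        zeval_fractions algebraic_int_zeval_root)
next
  have "x \<in> range (zeval \<theta>)"
    if "N \<noteq> 0" "x = zeval \<theta> q / of_int N" "algebraic_int x" for x q N
    using that
  proof (induction "nat \<bar>N\<bar>" arbitrary: N q rule: less_induct)
    case less
    show ?case
    proof (cases "is_unit N")
      case True
      then have "N = 1 \<or> N = -1" by (auto simp: zdvd1_eq abs_if split: if_splits)
      then have "x = zeval \<theta> (smult N q)" using less.prems(2) by auto
      then show ?thesis by blast
    next
      case False
      then obtain p where p: "prime p" "p dvd N"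
        using prime_divisorE[OF less.prems(1)] by blast
      then obtain M where N: "N = p * M" by (elim dvdE)
      have "p > 1" using p(1) by (rule prime_gt_1_int)
      have M: "M \<noteq> 0" using less.prems(1) N by auto
      have "of_int M * x = zeval \<theta> q / of_int p"
        using M less.prems(2) by (simp add: N)
      moreover have "algebraic_int (of_int M * x)"
        using less.prems(3) by (intro algebraic_int_add_mult) auto
      ultimately obtain h' where h': "zeval \<theta> q = of_int p * zeval \<theta> h'"
        using assms[OF p(1), of q] by auto
      have "x = zeval \<theta> h' / of_int M"
        using less.prems(2) h' \<open>p > 1\<close> by (simp add: N)
      moreover have "nat \<bar>M\<bar> < nat \<bar>N\<bar>"
        using \<open>p > 1\<close> M by (simp add: N abs_mult)
      ultimately show ?thesis using less.hyps less.prems(3) M by blast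
    qed
  qed
  then show "ring_of_integers (rat_adjoin \<theta>) \<subseteq> int_adjoin \<theta>"
    by (auto simp: int_adjoin_zeval ring_of_integers_def rat_adjoin_eq_fractions elim!: fractionsE)
qed

end

section \<open>The polynomials \<open>X^n + A (B X + 1)^m\<close>\<close>

definition poly_ideal :: "int poly set \<Rightarrow> bool" where
  "poly_ideal I \<longleftrightarrow> (\<forall>g\<in>I. \<forall>h\<in>I. g + h \<in> I) \<and> (\<forall>g\<in>I. \<forall>q. q * g \<in> I)"

lemma poly_ideal_add: "poly_ideal I \<Longrightarrow> g \<in> I \<Longrightarrow> h \<in> I \<Longrightarrow> g + h \<in> I"
  and poly_ideal_mult: "poly_ideal I \<Longrightarrow> g \<in> I \<Longrightarrow> q * g \<in> I"
  by (auto simp: poly_ideal_def)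

lemma poly_ideal_diff: "poly_ideal I \<Longrightarrow> g \<in> I \<Longrightarrow> h \<in> I \<Longrightarrow> g - h \<in> I"
  using poly_ideal_add[of I g "- 1 * h"] poly_ideal_mult[of I h "- 1"] by simp

text \<open>An integer prime to p is a unit modulo p, hence modulo I.\<close>

lemma poly_ideal_cancel_const:
  assumes I: "poly_ideal I" and p: "prime p" "[:p:] \<in> I" and c: "\<not> p dvd c" "smult c g \<in> I"
  shows "g \<in> I"
proof -
  have "coprime c p" using p(1) c(1) by (metis coprime_commute prime_imp_coprime)
  then obtain u v where uv: "u * c + v * p = 1" by (metis bezout_int coprime_imp_gcd_eq_1)
  have "[:u:] * smult c g + smult v g * [:p:] = smult (u * c + v * p) g"
    by (simp add: smult_add_left mult.commute)
  then have "g = [:u:] * smult c g + smult v g * [:p:]" by (simp add: uv)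
  also have "\<dots> \<in> I" by (intro poly_ideal_add poly_ideal_mult I p c)
  finally show ?thesis .
qed

text \<open>Modulo I the polynomial w vanishes, so w(a) is a multiple of X - a; as w(a) is a unit
  modulo p, so is X - a modulo I.\<close>

lemma poly_ideal_cancel_linear:
  assumes I: "poly_ideal I" and p: "prime p" "[:p:] \<in> I"
    and w: "w \<in> I" "\<not> p dvd poly w a" and g: "[:-a, 1:] * g \<in> I"
  shows "g \<in> I"
proof (rule poly_ideal_cancel_const[OF I p w(2)])
  have "smult c g = g * (l * s + [:c:]) - s * (l * g)" for c l s
    by (simp add: algebra_simps)
  then have "smult (poly w a) g = g * ([:-a, 1:] * synthetic_div w a + [:poly w a:]) -
      synthetic_div w a * ([:-a, 1:] * g)" .
  also have "\<dots> = g * w - synthetic_div w a * ([:-a, 1:] * g)"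
    by (simp only: synthetic_div_correct')
  also have "\<dots> \<in> I" by (intro poly_ideal_diff poly_ideal_mult I w g)
  finally show "smult (poly w a) g \<in> I" .
qed

lemma poly_ideal_cancel_monom:
  assumes I: "poly_ideal I" and p: "prime p" "[:p:] \<in> I"
    and w: "w \<in> I" "\<not> p dvd poly w 0" and g: "monom 1 k * g \<in> I"
  shows "g \<in> I"
  using g
proof (induction k)
  case (Suc k)
  have "[:-0, 1:] * (monom 1 k * g) \<in> I"
    using Suc.prems by (simp add: monom_Suc)
  then have "monom 1 k * g \<in> I" by (rule poly_ideal_cancel_linear[OF I p w])
  then show ?case by (rule Suc.IH)
qed simp

lemma not_squarefree_int_iff:
  "\<not> squarefree (N :: int) \<longleftrightarrow> (\<exists>p. prime p \<and> p\<^sup>2 dvd N)"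
proof
  assume "\<not> squarefree N"
  then obtain x where x: "x\<^sup>2 dvd N" "\<not> is_unit x" by (auto simp: squarefree_def)
  show "\<exists>p. prime p \<and> p\<^sup>2 dvd N"
  proof (cases "x = 0")
    \<comment> \<open>Here N = 0, and the square of any prime divides it.\<close>
    case True
    then have "prime (2 :: int)" "2\<^sup>2 dvd N" using x by auto
    then show ?thesis by blast
  next
    case False
    then obtain p where "prime p" "p dvd x" using x(2) prime_divisorE by blast
    then show ?thesis using x(1) by (meson dvd_power_same dvd_trans)
  qed
next
  assume "\<exists>p. prime p \<and> p\<^sup>2 dvd N"
  then obtain p where "prime p" "p\<^sup>2 dvd N" by blast
  then show "\<not> squarefree N" using not_prime_unit[of p] unfolding squarefree_def by blast
qed

lemma power2_dvd_imp_dvd: "p\<^sup>2 dvd x \<Longrightarrow> p dvd (x :: int)"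
  by (rule dvd_trans[of p "p\<^sup>2"]) (simp_all add: power2_eq_square)

section \<open>Arithmetic of f, its derivative and D\<close>

locale power_of_linear =
  fixes A B D :: int and n m :: nat and f :: "int poly"
  assumes m: "1 \<le> m" "m < n" "n > 2"
    and gcd: "gcd (int n) (int m * B) = 1"
    and f_eq: "f = monom 1 n + smult A ([:1, B:] ^ m)"
    and D_eq: "D = int n ^ n + (-1) ^ (n + m) * B ^ n * (int n - int m) ^ (n - m) * int m ^ m * A"
begin

lemma poly_f: "poly f a = a ^ n + A * (B * a + 1) ^ m"
  by (simp add: f_eq poly_monom algebra_simps)

lemma poly_f_0: "poly f 0 = A"
  using m by (simp add: poly_f)

lemma degree_f: "degree f = n" and lead_coeff_f: "lead_coeff f = 1"
proof -
  have "degree ([:1, B:] ^ m) \<le> degree [:1, B:] * m" by (rule degree_power_le)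
  also have "\<dots> \<le> m" by simp
  finally have "degree (smult A ([:1, B:] ^ m)) < n"
    using m degree_smult_le[of A "[:1, B:] ^ m"] by linarith
  then have *: "degree (smult A ([:1, B:] ^ m)) < degree (monom (1 :: int) n)"
    by (simp add: degree_monom_eq)
  then show deg: "degree f = n"
    unfolding f_eq by (simp add: degree_add_eq_left degree_monom_eq)
  show "lead_coeff f = 1"
    unfolding deg using * by (simp add: f_eq coeff_eq_0 degree_monom_eq del: coeff_smult)
qed

definition E :: int where "E = B * (int n - int m)"

text \<open>The multiples of (B X + 1)^m cancel, and n X^(n-1) (B X + 1) - m B X^n remains.\<close>

lemma pderiv_identity:
  "[:1, B:] * pderiv f - smult (int m * B) f = monom 1 (n - 1) * [:int n, E:]"
proof -
  define P :: "int poly" where "P = monom 1 (n - 1)"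
  define Q where "Q = [:1, B:] ^ (m - 1)"
  have n: "monom 1 n = pCons 0 P" using m by (cases n) (simp_all add: P_def monom_Suc)
  have Q: "[:1, B:] ^ m = [:1, B:] * Q" using m by (cases m) (simp_all add: Q_def)
  have "pderiv (monom 1 n) = smult (int n) P" by (simp add: pderiv_monom P_def smult_monom)
  moreover have "pderiv ([:1, B:] ^ m) = smult (int m) (Q * [:B:])"
    by (simp add: pderiv_power Q_def pderiv_pCons)
  ultimately have "pderiv f = smult (int n) P + smult (A * int m * B) Q"
    by (simp add: f_eq pderiv_add pderiv_smult mult_ac)
  then show ?thesis
    unfolding f_eq Q n P_def[symmetric] E_def
    by (simp add: poly_eq_iff coeff_pCons algebra_simps split: nat.splits)
qed

lemma prime_dvd_n:
  assumes "prime p" "p dvd int n"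
  shows "\<not> p dvd B" "\<not> p dvd int m" "\<not> p dvd int n - int m"
proof -
  have "\<not> p dvd int m * B"
  proof
    assume "p dvd int m * B"
    with assms(2) have "p dvd 1" using gcd_greatest[of p "int n" "int m * B"] gcd by simp
    with assms(1) show False by (simp add: not_prime_unit)
  qed
  then show "\<not> p dvd B" "\<not> p dvd int m" by (auto intro: dvd_mult dvd_mult2)
  then show "\<not> p dvd int n - int m" using assms(2) by (simp add: dvd_diff_right_iff)
qed

text \<open>The exponents n and n - m are positive, so a prime dividing E divides the second summand
  of D, hence also n^n.\<close>

lemma prime_dvd_D:
  assumes p: "prime p" "p dvd D" "\<not> p dvd int n"
  shows "\<not> p dvd E"
proof
  let ?T = "(-1) ^ (n + m) * B ^ n * (int n - int m) ^ (n - m) * int m ^ m * A"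
  assume "p dvd E"
  then have "p dvd B \<or> p dvd int n - int m" using p(1) by (simp add: E_def prime_dvd_mult_iff)
  then have "p dvd B ^ n \<or> p dvd (int n - int m) ^ (n - m)"
    using m by (auto intro: dvd_trans dvd_power)
  then have "p dvd ?T" by (auto intro: dvd_mult dvd_mult2)
  then have "p dvd int n ^ n" using p(2) by (simp add: D_eq dvd_add_left_iff)
  with p(1,3) show False using prime_dvd_power by blast
qed

text \<open>If E a is congruent to -n, then E (B a + 1) is congruent to E - B n = -B m. Splitting
  E^n as E^m E^(n-m) clears the denominators in both terms of f(a).\<close>

lemma poly_f_cong:
  assumes "q dvd E * a + int n"
  shows "[E ^ n * poly f a = (-1) ^ n * D] (mod q)"
proof -
  have 1: "[E * a = - int n] (mod q)"
    using assms by (simp add: cong_iff_dvd_diff)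
  have "E * (B * a + 1) - (- (B * int m)) = B * (E * a + int n)"
    by (simp add: E_def algebra_simps)
  then have 2: "[E * (B * a + 1) = - (B * int m)] (mod q)"
    using assms by (simp only: cong_iff_dvd_diff) simp
  have "E ^ n = E ^ m * E ^ (n - m)" using m by (simp flip: power_add)
  then have "E ^ n * poly f a = (E * a) ^ n + A * (E * (B * a + 1)) ^ m * E ^ (n - m)"
    unfolding poly_f power_mult_distrib by (simp add: distrib_left mult_ac)
  also have "[\<dots> = (- int n) ^ n + A * (- (B * int m)) ^ m * E ^ (n - m)] (mod q)"
    by (intro cong_add cong_mult cong_pow 1 2 cong_refl)
  also have "(- int n) ^ n + A * (- (B * int m)) ^ m * E ^ (n - m) = (-1) ^ n * D"
  proof -
    have "B ^ n = B ^ m * B ^ (n - m)" using m by (simp flip: power_add)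
    moreover have "(-1 :: int) ^ n * (-1) ^ (n + m) = (-1) ^ m"
      by (simp add: power_add mult.assoc[symmetric] flip: power_mult_distrib)
    ultimately show ?thesis
      using power_minus[of "int n" n] power_minus[of "B * int m" m]
      by (simp add: D_eq E_def power_mult_distrib distrib_left mult_ac)
  qed
  finally show ?thesis .
qed

text \<open>The residue -n/E is taken modulo p^2 and not only modulo p, because f and its derivative
  are to be tested for divisibility by p^2 there.\<close>

lemma obtain_double_root:
  assumes "prime p" "\<not> p dvd E"
  obtains a where "p\<^sup>2 dvd E * a + int n"
proof -
  have "coprime E (p\<^sup>2)" using assms by (metis coprime_commute coprime_power_right_iff prime_imp_coprime)
  then obtain x where "[E * x = 1] (mod p\<^sup>2)" using cong_solve_coprime_int by blast
  then have "[E * x * int n = 1 * int n] (mod p\<^sup>2)" by (intro cong_mult cong_refl)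
  then have "p\<^sup>2 dvd E * (- x * int n) + int n"
    by (simp add: cong_iff_dvd_diff dvd_diff_commute mult.assoc)
  then show ?thesis by (rule that)
qed

text \<open>Since n > 2, p^2 divides n^n, and by the gcd condition the cofactor of A in D is prime
  to p.\<close>

lemma p_squared_dvd_A_iff_D:
  assumes p: "prime p" "p dvd int n"
  shows "p\<^sup>2 dvd A \<longleftrightarrow> p\<^sup>2 dvd D"
proof -
  define T where "T = (-1) ^ (n + m) * B ^ n * (int n - int m) ^ (n - m) * int m ^ m"
  have "p\<^sup>2 dvd int n ^ 2" using p(2) by (rule dvd_power_same)
  also have "int n ^ 2 dvd int n ^ n" using m by (intro le_imp_power_dvd) simp
  finally have "p\<^sup>2 dvd D \<longleftrightarrow> p\<^sup>2 dvd T * A"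
    by (simp add: D_eq T_def dvd_add_right_iff)
  moreover have "coprime (p\<^sup>2) T"
    using prime_dvd_n[OF p] p(1) by (simp add: T_def prime_imp_coprime)
  ultimately show ?thesis by (simp add: coprime_dvd_mult_right_iff)
qed

lemma not_squarefree_double_root:
  assumes "\<not> (squarefree A \<and> squarefree D)"
  obtains p a where "prime p" "p\<^sup>2 dvd poly f a" "p\<^sup>2 dvd poly (pderiv f) a"
proof -
  have identity: "(1 + B * a) * poly (pderiv f) a - int m * B * poly f a = a ^ (n - 1) * (E * a + int n)" for a
    using arg_cong[OF pderiv_identity, of "\<lambda>g. poly g a"] by (simp add: poly_monom algebra_simps)
  consider p where "prime p" "p\<^sup>2 dvd A" | p where "prime p" "p\<^sup>2 dvd D" "\<not> p\<^sup>2 dvd A"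
    using assms not_squarefree_int_iff by metis
  then show ?thesis
  proof cases
    case 1
    \<comment> \<open>The right side of the identity vanishes at 0 because n - 1 > 0.\<close>
    have "poly (pderiv f) 0 = int m * B * A"
      using identity[of 0] m by (simp add: poly_f_0 zero_power)
    then show ?thesis using 1 by (intro that[of p 0]) (auto simp: poly_f_0)
  next
    case 2
    then have n: "\<not> p dvd int n" using p_squared_dvd_A_iff_D by blast
    have "p dvd D" using 2(2) by (rule power2_dvd_imp_dvd)
    have E: "\<not> p dvd E" using prime_dvd_D[OF 2(1) \<open>p dvd D\<close> n] .
    obtain a where a: "p\<^sup>2 dvd E * a + int n" using obtain_double_root[OF 2(1) E] .
    have "p\<^sup>2 dvd (-1) ^ n * D" using 2(2) by simp
    then have "p\<^sup>2 dvd E ^ n * poly f a" using cong_dvd_iff[OF poly_f_cong[OF a]] by simp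
    moreover have coprime_E: "coprime (p\<^sup>2) (E ^ n)" using 2(1) E by (simp add: prime_imp_coprime)
    ultimately have f_a: "p\<^sup>2 dvd poly f a" by (simp add: coprime_dvd_mult_right_iff)
    \<comment> \<open>This makes 1 + B a cancellable modulo p^2 in the identity. Otherwise f(a) is
      congruent to a^n modulo p, so p divides a and then 1.\<close>
    have "\<not> p dvd 1 + B * a"
    proof
      assume *: "p dvd 1 + B * a"
      have p_f: "p dvd poly f a" using f_a by (rule power2_dvd_imp_dvd)
      have "p dvd A * (B * a + 1) ^ m"
        using * m by (intro dvd_mult dvd_trans[OF _ dvd_power]) (auto simp: add.commute)
      then have "p dvd a ^ n" using p_f by (simp add: poly_f dvd_add_left_iff)
      then have "p dvd a" using 2(1) prime_dvd_power by blast
      with * have "p dvd 1" by (simp add: dvd_add_left_iff)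
      with 2(1) show False by (simp add: not_prime_unit)
    qed
    then have "coprime (p\<^sup>2) (1 + B * a)" using 2(1) by (simp add: prime_imp_coprime)
    moreover have "p\<^sup>2 dvd (1 + B * a) * poly (pderiv f) a"
    proof -
      have "(1 + B * a) * poly (pderiv f) a = a ^ (n - 1) * (E * a + int n) + int m * B * poly f a"
        using identity[of a] by simp
      then show ?thesis using a f_a by simp
    qed
    ultimately have "p\<^sup>2 dvd poly (pderiv f) a" by (simp add: coprime_dvd_mult_right_iff)
    with 2(1) f_a show ?thesis by (rule that)
  qed
qed

text \<open>In Z[X]/(w, d, p) both f and its derivative vanish, hence so does X^(n-1) (E X + n). If
  p divided w(a) only where p^2 divides f(a), then X would be a unit there because p^2 does not
  divide A, and X + n/E because p^2 does not divide D. So 1 would lie in the ideal.\<close>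

lemma squarefree_imp_criterion:
  assumes sf: "squarefree A" "squarefree D" and p: "prime p"
    and f: "f = d * w + smult p r"
    and nonunit: "\<nexists>\<alpha> \<beta> \<gamma>. 1 = w * \<alpha> + d * \<gamma> + smult p \<beta>"
  shows "\<exists>a. p dvd poly w a \<and> \<not> p\<^sup>2 dvd poly f a"
proof (rule ccontr)
  assume contra: "\<not> ?thesis"
  have A: "\<not> p\<^sup>2 dvd A" and D: "\<not> p\<^sup>2 dvd D"
    using sf p not_squarefree_int_iff[of A] not_squarefree_int_iff[of D] by blast+
  define I where "I = {w * \<alpha> + d * \<gamma> + smult p \<beta> |\<alpha> \<beta> \<gamma>. True}"
  have I: "poly_ideal I"
    unfolding poly_ideal_def
  proof (intro conjI ballI allI)
    fix g h assume "g \<in> I" "h \<in> I"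
    then obtain \<alpha> \<beta> \<gamma> \<alpha>' \<beta>' \<gamma>' where
      "g = w * \<alpha> + d * \<gamma> + smult p \<beta>" "h = w * \<alpha>' + d * \<gamma>' + smult p \<beta>'"
      by (auto simp: I_def)
    then have "g + h = w * (\<alpha> + \<alpha>') + d * (\<gamma> + \<gamma>') + smult p (\<beta> + \<beta>')"
      by (simp add: algebra_simps smult_add_right)
    then show "g + h \<in> I" unfolding I_def by blast
  next
    fix g q assume "g \<in> I"
    then obtain \<alpha> \<beta> \<gamma> where "g = w * \<alpha> + d * \<gamma> + smult p \<beta>"
      by (auto simp: I_def)
    then have "q * g = w * (q * \<alpha>) + d * (q * \<gamma>) + smult p (q * \<beta>)"
      by (simp add: algebra_simps)
    then show "q * g \<in> I" unfolding I_def by blast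
  qed
  have IE: "g \<in> I" if "g = w * \<alpha> + d * \<gamma> + smult p \<beta>" for g \<alpha> \<beta> \<gamma>
    using that unfolding I_def by blast
  have pI: "[:p:] \<in> I" by (rule IE[of _ 0 0 1]) simp
  have wI: "w \<in> I" by (rule IE[of _ 1 0 0]) simp
  have fI: "f \<in> I" by (rule IE[of _ d 0 r]) (simp add: f mult.commute)
  have "pderiv f \<in> I"
    by (rule IE[of _ "pderiv d" "pderiv w" "pderiv r"])
       (simp add: f pderiv_add pderiv_mult pderiv_smult)
  then have "monom 1 (n - 1) * [:int n, E:] \<in> I"
    unfolding pderiv_identity[symmetric]
    using poly_ideal_mult[OF I fI, of "[:int m * B:]"]
    by (intro poly_ideal_diff poly_ideal_mult I) simp_all
  moreover have one: "1 \<notin> I" using nonunit by (auto simp: I_def)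
  have w0: "\<not> p dvd poly w 0"
    using contra A by (metis poly_f_0)
  ultimately have L: "[:int n, E:] \<in> I"
    using poly_ideal_cancel_monom[OF I p pI wI] by blast
  have pA: "\<not> p dvd A"
  proof
    assume "p dvd A"
    then obtain A' where A': "A = p * A'" by (elim dvdE)
    have "monom 1 n * 1 = f - smult A' ([:1, B:] ^ m) * [:p:]"
      by (simp add: f_eq A' mult.commute)
    also have "\<dots> \<in> I" by (rule poly_ideal_diff[OF I fI poly_ideal_mult[OF I pI]])
    finally have "1 \<in> I" by (rule poly_ideal_cancel_monom[OF I p pI wI w0])
    with one show False by simp
  qed
  show False
  proof (cases "p dvd E")
    case True
    then obtain E' where E': "E = p * E'" by (elim dvdE)
    \<comment> \<open>If p divides E, the linear polynomial reduces to the constant n, which is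
      prime to p since p divides B or n - m.\<close>
    have "smult (int n) 1 = [:int n, E:] - monom E' 1 * [:p:]"
      by (simp add: E' monom_Suc monom_0 mult.commute)
    also have "\<dots> \<in> I" by (rule poly_ideal_diff[OF I L poly_ideal_mult[OF I pI]])
    finally have nI: "smult (int n) 1 \<in> I" .
    have "p dvd B \<or> p dvd int n - int m" using True p by (simp add: E_def prime_dvd_mult_iff)
    then have "\<not> p dvd int n" using prime_dvd_n[OF p] by blast
    from poly_ideal_cancel_const[OF I p pI this nI] one show False by simp
  next
    case False
    obtain a where a: "p\<^sup>2 dvd E * a + int n" using obtain_double_root[OF p False] .
    then have "p dvd E * a + int n" by (rule power2_dvd_imp_dvd)
    then obtain t where t: "E * a + int n = p * t" by (elim dvdE)
    have "\<not> p dvd poly w a"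
    proof
      assume "p dvd poly w a"
      then have "p\<^sup>2 dvd poly f a" using contra by blast
      then have "p\<^sup>2 dvd (-1) ^ n * D"
        using cong_dvd_iff[OF poly_f_cong[OF a]] by simp
      then have "p\<^sup>2 dvd (-1) ^ n * ((-1) ^ n * D)" by (rule dvd_mult)
      then have "p\<^sup>2 dvd D" by (simp flip: mult.assoc power_mult_distrib)
      with D show False by simp
    qed
    \<comment> \<open>Modulo p the linear polynomial E X + n is E (X - a); first X - a and then E is
      cancelled.\<close>
    moreover have "[:-a, 1:] * smult E 1 \<in> I"
    proof -
      have "int n = p * t - E * a" using t by simp
      then have "[:-a, 1:] * smult E 1 = [:int n, E:] - [:t:] * [:p:]"
        by (simp add: mult.commute)
      also have "\<dots> \<in> I" by (rule poly_ideal_diff[OF I L poly_ideal_mult[OF I pI]])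
      finally show ?thesis .
    qed
    ultimately have "smult E 1 \<in> I" by (rule poly_ideal_cancel_linear[OF I p pI wI])
    from poly_ideal_cancel_const[OF I p pI False this] one show False by simp
  qed
qed

end

theorem theorem4p1:
  fixes A B D :: int and n m :: nat and f :: "int poly"
  assumes "B \<noteq> 0"
    and "1 \<le> m" and "m < n" and "n > 2"
    and "gcd (int n) (int m * B) = 1"
    and f_eq: "f = monom 1 n + smult A ([:1, B:] ^ m)"
    and "irreducible (map_poly rat_of_int f)"
    and D_eq: "D = int n ^ n + (-1) ^ (n + m) * B ^ n * (int n - int m) ^ (n - m) * int m ^ m * A"
  shows "monogenic f \<longleftrightarrow> squarefree A \<and> squarefree D"
proof -
  interpret power_of_linear A B D n m f
    by unfold_locales (fact assms)+
  have at_root: "monic_root f \<theta>" if "poly (map_poly of_int f) \<theta> = 0" for \<theta> :: complex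
    using that assms(7) lead_coeff_f by (simp add: monic_root_def zeval_def)
  \<comment> \<open>\<open>monogenic\<close> quantifies over all complex roots, so an actual root is
    produced: it refutes monogenicity in one direction and gives irreducibility over Z in the
    other.\<close>
  have "degree (map_poly complex_of_int f) > 0"
    using assms degree_f by simp
  then have "\<not> constant (poly (map_poly complex_of_int f))"
    by (simp add: constant_degree)
  then obtain \<theta> :: complex where \<theta>: "poly (map_poly of_int f) \<theta> = 0"
    using fundamental_theorem_of_algebra by blast
  show ?thesis
  proof
    assume mono: "monogenic f"
    show "squarefree A \<and> squarefree D"
    proof (rule ccontr)
      assume "\<not> ?thesis"
      then obtain p a where "prime p" "p\<^sup>2 dvd poly f a" "p\<^sup>2 dvd poly (pderiv f) a"
        by (rule not_squarefree_double_root)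
      moreover have "degree f \<ge> 2" using degree_f assms(4) by simp
      ultimately have "int_adjoin \<theta> \<noteq> ring_of_integers (rat_adjoin \<theta>)"
        using monic_root.double_root_not_maximal[OF at_root[OF \<theta>]] by blast
      with mono \<theta> show False unfolding monogenic_def by blast
    qed
  next
    assume sf: "squarefree A \<and> squarefree D"
    have "int_adjoin \<theta> = ring_of_integers (rat_adjoin \<theta>)"
      if "poly (map_poly of_int f) \<theta> = 0" for \<theta> :: complex
    proof -
      interpret monic_root f \<theta> using that by (rule at_root)
      show ?thesis
      proof (rule int_adjoin_eq_ring_of_integers)
        fix p :: int and h
        assume "prime p" "algebraic_int (zeval \<theta> h / of_int p)"
        then show "\<exists>h'. zeval \<theta> h = of_int p * zeval \<theta> h'"
        proof (intro simple_root_criterion[of p h])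
          show "\<exists>a. p dvd poly w a \<and> \<not> p\<^sup>2 dvd poly f a"
            if "f = d * w + smult p r" "\<nexists>\<alpha> \<beta> \<gamma>. 1 = w * \<alpha> + d * \<gamma> + smult p \<beta>" for d w r
            using squarefree_imp_criterion[OF _ _ \<open>prime p\<close> that] sf by blast
        qed
      qed
    qed
    then show "monogenic f"
      using lead_coeff_f monic_root.irreducible_int[OF at_root[OF \<theta>]]
      unfolding monogenic_def by blast
  qed
qed

end
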